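(* Let $k>1$ and let $\mathcal P$ be a commensurable $k$-pattern on $\mathbb R$ whose enveloping pattern is $\mathcal A_\ell$ (the $\ell$-term arithmetic progressions). If $n$ is a positive integer and $r$ and $s$ are the remainders when $n$ is divided by $k-1$ and by $\ell-1$ respectively, then \[ \frac{(n-s)(n+s-\ell+1)}{2\ell-2}\le S_{\mathcal P}(n)\le\frac{(n-r)(n+r-k+1)}{2k-2}. \]
   Context: A direct similarity of $\mathbb R$ is a map $x\mapsto ax+b$ with $a>0$. A $k$-pattern on $\mathbb R$ is the set $\mathcal P$ of all images under direct similarities of a fixed $k$-element set $P_0\subseteq\mathbb R$; it is commensurable if $P_0$ can be taken to be a subset of $\mathbb Z$ (equivalently, all ratios of distances between points of $P_0$ are rational). For such $P_0$, its enveloping arithmetic progression is the arithmetic progression of minimum cardinality containing $P_0$; if this has $\ell$ terms, the enveloping pattern of $\mathcal P$ is $\mathcal A_\ell$, the set of all $\ell$-term arithmetic progressions $\{a,a+d,\dots,a+(\ell-1)d\}$, $d>0$. For finite $V\subseteq\mathbb R$, $S_{\mathcal P}(V)=|\{P\subseteq V:P\in\mathcal P\}|$ and $S_{\mathcal P}(n)=\max\{S_{\mathcal P}(V):|V|=n\}$. *)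

theory Defs
  imports Complex_Main
begin

definition dsim :: "real \<Rightarrow> real \<Rightarrow> real \<Rightarrow> real" where
  "dsim a b x = a * x + b"

definition pattern :: "real set \<Rightarrow> real set set" where
  "pattern P0 = {dsim a b ` P0 | a b. a > 0}"

definition commensurable :: "real set \<Rightarrow> bool" where
  "commensurable P0 \<longleftrightarrow> (\<exists>P \<in> pattern P0. P \<subseteq> \<int>)"

definition arith_prog :: "real \<Rightarrow> real \<Rightarrow> nat \<Rightarrow> real set" where
  "arith_prog a d l = {a + real i * d | i. i < l}"

definition AP_pattern :: "nat \<Rightarrow> real set set" where
  "AP_pattern l = {arith_prog a d l | a d. d > 0}"

text \<open>Number of terms of the enveloping arithmetic progression of P0
  (the arithmetic progression of minimum cardinality containing P0).\<close>
definition env_len :: "real set \<Rightarrow> nat" where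
  "env_len P0 = (LEAST l. \<exists>A \<in> AP_pattern l. P0 \<subseteq> A)"

definition S_count :: "real set set \<Rightarrow> real set \<Rightarrow> nat" where
  "S_count \<P> V = card {P. P \<subseteq> V \<and> P \<in> \<P>}"

definition S_max :: "real set set \<Rightarrow> nat \<Rightarrow> nat" where
  "S_max \<P> n = Max {S_count \<P> V | V. finite V \<and> card V = n}"

end

(*
  Upper bound: split V, in increasing order, into k - 1 consecutive blocks of size
  floor(n / (k-1)) or one more.  For every copy p_0 < ... < p_(k-1) of P0 in V there is an i such
  that p_i and p_(i+1) both lie in the i-th block, and i, p_i and p_(i+1) determine the copy.
  So there are at most as many copies as pairs of points within a block.

  Lower bound: in V = {0, ..., n-1} every l-term progression contains a copy of P0, and as P0
  contains both ends of its enveloping progression, different progressions give different copies.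
*)
theory Submission
  imports Defs
begin

section \<open>Blocks of consecutive points and the upper bound\<close>

lemma exists_index_in_block:
  fixes j c :: "nat \<Rightarrow> nat"
  assumes "c 0 = 0" and "j m < c m"
  obtains i where "i < m" and "c i \<le> j i" and "j (Suc i) < c (Suc i)"
proof -
  \<comment> \<open>The first index with \<open>j i < c i\<close> is positive because
    \<open>c 0 = 0\<close>; its predecessor is the index sought.\<close>
  define i where "i = (LEAST i. j i < c i)"
  have i: "j i < c i" unfolding i_def by (rule LeastI) (rule assms(2))
  with assms(1) obtain i' where i': "i = Suc i'" by (cases i) auto
  have "i \<le> m" unfolding i_def by (rule Least_le) (rule assms(2))
  moreover have "\<not> j i' < c i'" using not_less_Least[of i' "\<lambda>i. j i < c i"] i' by (simp add: i_def)
  ultimately show ?thesis using that[of i'] i i' by auto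
qed

text \<open>Block \<open>i\<close> runs from \<open>block_start q r i\<close> up to, but excluding,
  the start of block \<open>Suc i\<close>. The first \<open>r\<close> blocks have
  \<open>q + 1\<close> positions, the others \<open>q\<close>; \<open>min i r\<close> counts the
  longer blocks before block \<open>i\<close>.\<close>

definition block_start :: "nat \<Rightarrow> nat \<Rightarrow> nat \<Rightarrow> nat" where
  "block_start q r i = i * q + min i r"

lemma block_start_0: "block_start q r 0 = 0"
  by (simp add: block_start_def)

lemma block_start_div_mod: "0 < m \<Longrightarrow> block_start (n div m) (n mod m) m = n"
  by (simp add: block_start_def min.absorb2 less_imp_le)

lemma block_start_Suc: "block_start q r (Suc i) = block_start q r i + (q + (if i < r then 1 else 0))"
  by (auto simp: block_start_def)

text \<open>The larger position \<open>y\<close> precedes the smaller one \<open>x\<close>, so that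
  for fixed \<open>y\<close> the choices of \<open>x\<close> form an interval and the cardinality is
  a sum of interval lengths.\<close>

definition block_pairs :: "nat \<Rightarrow> nat \<Rightarrow> nat \<Rightarrow> (nat \<times> nat \<times> nat) set" where
  "block_pairs q r m = (SIGMA i:{..<m}. SIGMA y:{block_start q r i..<block_start q r (Suc i)}.
     {block_start q r i..<y})"

lemma finite_block_pairs: "finite (block_pairs q r m)"
  by (simp add: block_pairs_def)

text \<open>Each block contributes q(q-1)/2 pairs, and each of the \<open>r\<close> longer blocks
  another \<open>q\<close>.\<close>

lemma card_block_pairs:
  assumes "r \<le> m"
  shows "real (card (block_pairs q r m)) = real q * (real m * (real q - 1) + 2 * real r) / 2"
proof -
  have pairs: "(\<Sum>y = s..<s + t. real (y - s)) = real t * (real t - 1) / 2" for s t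
    by (induction t) (auto simp: field_simps)
  have "real (card (block_pairs q r m))
      = (\<Sum>i<m. \<Sum>y = block_start q r i..<block_start q r (Suc i). real (y - block_start q r i))"
    by (simp add: block_pairs_def)
  also have "\<dots> = (\<Sum>i<m. real q * (real q - 1) / 2 + (if i < r then real q else 0))"
    unfolding block_start_Suc pairs by (rule sum.cong) (simp_all add: field_simps)
  also have "\<dots> = real m * (real q * (real q - 1) / 2) + (\<Sum>i<m. if i < r then real q else 0)"
    by (simp add: sum.distrib)
  also have "(\<Sum>i<m. if i < r then real q else 0) = (\<Sum>i\<in>{..<r}. real q)"
    using assms by (intro sum.mono_neutral_cong_right) auto
  finally show ?thesis by (simp add: field_simps)
qed

lemma S_count_le_card_block_pairs:
  assumes "finite P0" and "1 < card P0" and "finite V"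
  defines "m \<equiv> card P0 - 1"
  shows "S_count (pattern P0) V \<le> card (block_pairs (card V div m) (card V mod m) m)"
proof -
  define n where "n = card V"
  define xs where "xs = sorted_list_of_set P0"
  define vs where "vs = sorted_list_of_set V"
  have xs: "set xs = P0" "sorted_wrt (<) xs" "length xs = Suc m"
    using assms by (auto simp: xs_def)
  have vs: "set vs = V" "sorted_wrt (<) vs" "length vs = n"
    using assms by (auto simp: vs_def n_def)
  let ?c = "block_start (n div m) (n mod m)"
  \<comment> \<open>A direct similarity is determined by the images of two points: \<open>F\<close>
    uses the one taking \<open>xs ! i\<close> to \<open>vs ! x\<close> and \<open>xs ! Suc i\<close>
    to \<open>vs ! y\<close>. It suffices that every copy inside \<open>V\<close> is a value of
    \<open>F\<close>; other values may leave \<open>V\<close>.\<close>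
  define F where "F = (\<lambda>(i, y, x). let a = (vs ! y - vs ! x) / (xs ! Suc i - xs ! i)
    in dsim a (vs ! x - a * xs ! i) ` P0)"
  have "{P. P \<subseteq> V \<and> P \<in> pattern P0} \<subseteq> F ` block_pairs (n div m) (n mod m) m"
  proof safe
    fix P assume "P \<subseteq> V" "P \<in> pattern P0"
    then obtain a b where ab: "a > 0" "P = dsim a b ` P0" by (auto simp: pattern_def)
    have "\<exists>t<n. vs ! t = dsim a b (xs ! i)" if "i \<le> m" for i
    proof -
      have "xs ! i \<in> P0" using that xs nth_mem[of i xs] by simp
      then have "dsim a b (xs ! i) \<in> set vs" using ab \<open>P \<subseteq> V\<close> vs by auto
      then show ?thesis using vs by (auto simp: in_set_conv_nth)
    qed
    then obtain j where j: "\<And>i. i \<le> m \<Longrightarrow> j i < n" "\<And>i. i \<le> m \<Longrightarrow> vs ! j i = dsim a b (xs ! i)"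
      by metis
    \<comment> \<open>The last block ends at \<open>n\<close>, so the position \<open>j m\<close> of
      the largest point lies below \<open>?c m\<close>, as the choice of \<open>i\<close>
      requires.\<close>
    have "?c m = n" using assms by (intro block_start_div_mod) (simp add: m_def)
    then obtain i where i: "i < m" "?c i \<le> j i" "j (Suc i) < ?c (Suc i)"
      using exists_index_in_block[of ?c j m] j(1)[of m] by (auto simp: block_start_0)
    \<comment> \<open>So far \<open>j i\<close> is bounded below and \<open>j (Suc i)\<close> above.
      That \<open>j i < j (Suc i)\<close>, by \<open>a > 0\<close> and the sorting of
      \<open>vs\<close>, puts both into block \<open>i\<close>.\<close>
    have less: "xs ! i < xs ! Suc i" using xs i by (simp add: sorted_wrt_nth_less)
    then have "vs ! j i < vs ! j (Suc i)" using j i ab by (simp add: dsim_def)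
    then have "j i < j (Suc i)"
      using vs(2,3) j(1)[of i] i sorted_wrt_nth_less[OF vs(2), of "j (Suc i)" "j i"]
      by (cases "j i" "j (Suc i)" rule: linorder_cases) auto
    then have "(i, j (Suc i), j i) \<in> block_pairs (n div m) (n mod m) m"
      using i by (simp add: block_pairs_def)
    moreover have "F (i, j (Suc i), j i) = P"
    proof -
      have a: "(vs ! j (Suc i) - vs ! j i) / (xs ! Suc i - xs ! i) = a"
        using j i less by (simp add: dsim_def field_simps)
      have b: "vs ! j i - a * xs ! i = b" using j i by (simp add: dsim_def)
      show ?thesis unfolding F_def prod.case Let_def a b ab ..
    qed
    ultimately show "P \<in> F ` block_pairs (n div m) (n mod m) m" by force
  qed
  then have "S_count (pattern P0) V \<le> card (F ` block_pairs (n div m) (n mod m) m)"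
    unfolding S_count_def by (intro card_mono finite_imageI finite_block_pairs)
  also have "\<dots> \<le> card (block_pairs (n div m) (n mod m) m)"
    by (intro card_image_le finite_block_pairs)
  finally show ?thesis by (simp add: n_def)
qed

section \<open>The enveloping progression\<close>

lemma arith_prog_of_commensurable:
  assumes "finite P0" and "commensurable P0"
  shows "\<exists>l. \<exists>A \<in> AP_pattern l. P0 \<subseteq> A"
proof -
  obtain a b where ab: "a > 0" "dsim a b ` P0 \<subseteq> \<int>"
    using assms by (auto simp: commensurable_def pattern_def)
  \<comment> \<open>The integral copy lies between \<open>- N\<close> and \<open>N\<close>, a
    progression of \<open>2 * N + 1\<close> terms; the inverse similarity pulls it back to one with
    difference \<open>1 / a\<close>. Inserting \<open>0\<close> keeps the maximum well defined for
    empty \<open>P0\<close>.\<close>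
  define L where "L = Max (insert 0 ((\<lambda>x. \<bar>dsim a b x\<bar>) ` P0))"
  define N where "N = nat \<lceil>L\<rceil>"
  have "P0 \<subseteq> arith_prog ((- real N - b) / a) (1 / a) (2 * N + 1)"
  proof
    fix x assume x: "x \<in> P0"
    then obtain z where z: "dsim a b x = of_int z" using ab by (auto elim: Ints_cases)
    have "\<bar>dsim a b x\<bar> \<le> L" unfolding L_def using x assms by (intro Max_ge) auto
    also have "L \<le> real N" unfolding N_def by (rule real_nat_ceiling_ge)
    finally have "\<bar>z\<bar> \<le> int N" using z by linarith
    moreover have "x = (- real N - b) / a + real (nat (z + int N)) * (1 / a)"
      using z ab \<open>\<bar>z\<bar> \<le> int N\<close> by (simp add: dsim_def field_simps)
    ultimately show "x \<in> arith_prog ((- real N - b) / a) (1 / a) (2 * N + 1)"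
      unfolding arith_prog_def by (auto intro!: exI[of _ "nat (z + int N)"])
  qed
  moreover have "1 / a > 0" using ab by simp
  ultimately show ?thesis unfolding AP_pattern_def by blast
qed

text \<open>If an end of a shortest progression were missing from \<open>P0\<close>, dropping that
  end would leave a shorter one still containing \<open>P0\<close>. The two ends later tell copies
  apart.\<close>

lemma enveloping_prog:
  assumes "finite P0" and "1 < card P0" and "commensurable P0"
  obtains c d where "d > 0" and "P0 \<subseteq> arith_prog c d (env_len P0)"
    and "c \<in> P0" and "c + real (env_len P0 - 1) * d \<in> P0" and "1 < env_len P0"
proof -
  let ?Q = "\<lambda>l. \<exists>A \<in> AP_pattern l. P0 \<subseteq> A"
  define l where "l = env_len P0"
  have "?Q l" unfolding l_def env_len_def
    by (rule LeastI_ex) (rule arith_prog_of_commensurable[OF assms(1,3)])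
  then obtain c d where cd: "d > 0" "P0 \<subseteq> arith_prog c d l" by (auto simp: AP_pattern_def)
  have ap: "arith_prog c d l = (\<lambda>i. c + real i * d) ` {..<l}" for c d l
    by (auto simp: arith_prog_def)
  have "card P0 \<le> card (arith_prog c d l)" using cd by (intro card_mono) (auto simp: ap)
  also have "\<dots> \<le> l" using card_image_le[of "{..<l}" "\<lambda>i. c + real i * d"] by (simp add: ap)
  finally have l: "1 < l" using assms by simp
  \<comment> \<open>The start \<open>c'\<close> is left open because dropping the first term moves
    it to \<open>c + d\<close>.\<close>
  have min: "\<not> P0 \<subseteq> arith_prog c' d (l - 1)" for c'
  proof
    assume "P0 \<subseteq> arith_prog c' d (l - 1)"
    then have "?Q (l - 1)" using cd by (auto simp: AP_pattern_def)
    then have "l \<le> l - 1" unfolding l_def env_len_def by (rule Least_le)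
    then show False using l by simp
  qed
  have "c \<in> P0"
  proof (rule ccontr)
    assume "c \<notin> P0"
    have "P0 \<subseteq> arith_prog (c + d) d (l - 1)"
    proof
      fix x assume "x \<in> P0"
      then obtain i where i: "i < l" "x = c + real i * d" using cd by (auto simp: ap)
      with \<open>x \<in> P0\<close> \<open>c \<notin> P0\<close> obtain i' where "i = Suc i'" by (cases i) auto
      with i show "x \<in> arith_prog (c + d) d (l - 1)"
        by (auto simp: ap algebra_simps intro!: image_eqI[of _ _ i'])
    qed
    then show False using min by blast
  qed
  moreover have "c + real (l - 1) * d \<in> P0"
  proof (rule ccontr)
    assume last: "c + real (l - 1) * d \<notin> P0"
    have "P0 \<subseteq> arith_prog c d (l - 1)"
    proof
      fix x assume "x \<in> P0"
      then obtain i where i: "i < l" "x = c + real i * d" using cd by (auto simp: ap)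
      with \<open>x \<in> P0\<close> last have "i \<noteq> l - 1" by auto
      with i show "x \<in> arith_prog c d (l - 1)" by (auto simp: ap)
    qed
    then show False using min by blast
  qed
  ultimately show ?thesis using that cd l unfolding l_def by blast
qed

section \<open>Counting copies in an initial segment for the lower bound\<close>

lemma card_le_S_count_initial_segment:
  assumes "d > 0" and "P0 \<subseteq> arith_prog c d (Suc m)" and "c \<in> P0" and "c + real m * d \<in> P0"
    and "0 < m"
  shows "card (SIGMA t:{1..n div m}. {..<n - t * m}) \<le> S_count (pattern P0) (real ` {..<n})"
proof -
  \<comment> \<open>The similarity sends the term \<open>c + real i * d\<close> to
    \<open>s + i * t\<close>, so \<open>t\<close> is the new difference and \<open>s\<close> the new
    start. The last term is \<open>s + m * t\<close>, whence the condition
    \<open>s < n - t * m\<close>.\<close>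
  define G where "G = (\<lambda>(t, s). dsim (real t / d) (real s - c * real t / d) ` P0)"
  have on_prog: "dsim (real t / d) (real s - c * real t / d) (c + real i * d) = real (s + i * t)"
    for t s i using assms(1) by (simp add: dsim_def field_simps)
  have in_prog: "\<exists>i\<le>m. y = real (s + i * t)" if "y \<in> G (t, s)" for y t s
  proof -
    from that assms(2) obtain i where "i < Suc m"
      "y = dsim (real t / d) (real s - c * real t / d) (c + real i * d)"
      by (auto simp: G_def arith_prog_def)
    then show ?thesis using on_prog by (auto simp: less_Suc_eq_le)
  qed
  have fst_in: "real s \<in> G (t, s)" for t s
    using imageI[OF assms(3), of "dsim (real t / d) (real s - c * real t / d)"] on_prog[of t s 0]
    by (simp add: G_def)
  have lst_in: "real (s + m * t) \<in> G (t, s)" for t s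
    unfolding G_def prod.case on_prog[of t s m, symmetric] by (rule imageI) (rule assms(4))
  \<comment> \<open>The least point of \<open>G (t, s)\<close> is \<open>s\<close> and the greatest
    is \<open>s + m * t\<close>. Used in both directions, this makes the ends of equal copies agree,
    and \<open>0 < m\<close> then yields \<open>t = t'\<close>.\<close>
  have le: "s' \<le> s \<and> s + m * t \<le> s' + m * t'" if eq: "G (t, s) = G (t', s')" for t s t' s'
  proof -
    obtain i where "real s = real (s' + i * t')"
      using in_prog[of "real s" t' s'] fst_in[of s t] eq by auto
    then have "s' \<le> s" by linarith
    moreover obtain i where i: "i \<le> m" "real (s + m * t) = real (s' + i * t')"
      using in_prog[of "real (s + m * t)" t' s'] lst_in[of s t] eq by auto
    moreover have "i * t' \<le> m * t'" using i(1) by simp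
    ultimately show ?thesis by linarith
  qed
  have "inj_on G (SIGMA t:{1..n div m}. {..<n - t * m})"
  proof (rule inj_onI, clarify)
    fix t s t' s' assume "G (t, s) = G (t', s')"
    from le[OF this] le[OF this[symmetric]] have "s = s'" "m * t = m * t'" by linarith+
    then show "t = t' \<and> s = s'" using assms(5) by simp
  qed
  moreover have "G ` (SIGMA t:{1..n div m}. {..<n - t * m})
      \<subseteq> {P. P \<subseteq> real ` {..<n} \<and> P \<in> pattern P0}"
  proof clarify
    fix t s assume ts: "t \<in> {1..n div m}" "s < n - t * m"
    have "G (t, s) \<subseteq> real ` {..<n}"
    proof
      fix y assume "y \<in> G (t, s)"
      then obtain i where i: "i \<le> m" "y = real (s + i * t)" using in_prog by blast
      then have "i * t \<le> t * m" by (simp add: mult.commute)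
      with ts have "s + i * t < n" by linarith
      then show "y \<in> real ` {..<n}" using i by blast
    qed
    moreover have "G (t, s) \<in> pattern P0"
    proof -
      have "real t / d > 0" using assms(1) ts by simp
      then show ?thesis unfolding G_def pattern_def by auto
    qed
    ultimately show "G (t, s) \<subseteq> real ` {..<n} \<and> G (t, s) \<in> pattern P0" ..
  qed
  ultimately show ?thesis unfolding S_count_def by (intro card_inj_on_le) auto
qed

lemma card_arith_progs:
  "real (card (SIGMA t:{1..n div m}. {..<n - t * m}))
    = real (n div m) * (2 * real n - real m * (real (n div m) + 1)) / 2"
proof -
  have sum: "(\<Sum>t = 1..q. real n - real t * real m) = real q * (2 * real n - real m * (real q + 1)) / 2"
    for q by (induction q) (auto simp: field_simps)
  \<comment> \<open>This keeps the subtraction on naturals from truncating, so it agrees with the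
    real one.\<close>
  have "t * m \<le> n" if "t \<le> n div m" for t
    using that mult_le_mono1[OF that, of m] div_times_less_eq_dividend[of n m] by linarith
  then have "real (card (SIGMA t:{1..n div m}. {..<n - t * m}))
      = (\<Sum>t = 1..n div m. real n - real t * real m)"
    by (auto simp: of_nat_diff intro!: sum.cong simp flip: of_nat_mult)
  then show ?thesis by (simp only: sum)
qed

theorem mainTheorem12:
  fixes P0 :: "real set" and k l n :: nat
  assumes "finite P0" and "card P0 = k" and "k > 1"
    and "commensurable P0"
    and "l = env_len P0"
    and "n > 0"
  shows "real (n - n mod (l - 1)) * (real n + real (n mod (l - 1)) - real l + 1) / (2 * real l - 2)
           \<le> real (S_max (pattern P0) n)
       \<and> real (S_max (pattern P0) n)
           \<le> real (n - n mod (k - 1)) * (real n + real (n mod (k - 1)) - real k + 1) / (2 * real k - 2)"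
proof
  have k: "1 < card P0" using assms by simp
  let ?C = "{S_count (pattern P0) V | V. finite V \<and> card V = n}"
  let ?B = "card (block_pairs (n div (k - 1)) (n mod (k - 1)) (k - 1))"
  let ?V = "real ` {..<n}"
  have le_B: "x \<le> ?B" if "x \<in> ?C" for x
    using that S_count_le_card_block_pairs[OF assms(1) k] assms(2) by auto
  \<comment> \<open>There are infinitely many sets \<open>V\<close>, but the uniform bound
    \<open>?B\<close> leaves finitely many counts, so \<open>Max\<close> is attained.\<close>
  then have fin: "finite ?C" by (intro finite_subset[OF _ finite_atMost[of ?B]]) blast
  have V: "S_count (pattern P0) ?V \<in> ?C"
    by (intro CollectI exI[of _ ?V]) (simp add: card_image)
  then have max_ge: "S_count (pattern P0) ?V \<le> S_max (pattern P0) n"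
    unfolding S_max_def using fin by (intro Max_ge)
  have "S_max (pattern P0) n \<in> ?C"
    unfolding S_max_def using fin V by (intro Max_in) auto
  then have max_le: "S_max (pattern P0) n \<le> ?B" by (rule le_B)

  \<comment> \<open>For m = l - 1 or m = k - 1, with q = n div m and r = n mod m, the numerator has
    the factor n - r = qm and the denominator is 2m. By \<open>decomp\<close>, n + r - m equals both
    2n - m(q + 1), from the progressions, and m(q - 1) + 2r, from the blocks.\<close>
  have cancel: "real q * real m * x / (2 * real (Suc m) - 2) = real q * x / 2" if "0 < m" for q m x
    using that by simp
  have decomp: "real n = real (n div m) * real m + real (n mod m)" for m
    by (metis div_mult_mod_eq of_nat_add of_nat_mult)

  obtain c d where cd: "d > 0" "P0 \<subseteq> arith_prog c d l" "c \<in> P0" "c + real (l - 1) * d \<in> P0" "1 < l"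
    using enveloping_prog[OF assms(1) k assms(4)] assms(5) by blast
  define m where "m = l - 1"
  have m: "0 < m" "l = Suc m" using cd by (auto simp: m_def)
  have "card (SIGMA t:{1..n div m}. {..<n - t * m}) \<le> S_max (pattern P0) n"
    using card_le_S_count_initial_segment[of d P0 c m n] max_ge cd m by simp
  then have "real (n div m) * (2 * real n - real m * (real (n div m) + 1)) / 2
      \<le> real (S_max (pattern P0) n)"
    by (simp only: card_arith_progs[symmetric] of_nat_le_iff)
  moreover have "real (n - n mod m) = real (n div m) * real m"
    using decomp[of m] by (simp add: of_nat_diff)
  ultimately show "real (n - n mod (l - 1)) * (real n + real (n mod (l - 1)) - real l + 1)
      / (2 * real l - 2) \<le> real (S_max (pattern P0) n)"
    using m decomp[of m] by (simp add: cancel del: of_nat_Suc) (simp add: field_simps)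

  define m' where "m' = k - 1"
  have m': "0 < m'" "k = Suc m'" using assms by (auto simp: m'_def)
  have "n mod m' \<le> m'" using m' by (simp add: less_imp_le)
  then have "real (S_max (pattern P0) n)
      \<le> real (n div m') * (real m' * (real (n div m') - 1) + 2 * real (n mod m')) / 2"
    using max_le by (simp add: m'_def flip: card_block_pairs)
  moreover have "real (n - n mod m') = real (n div m') * real m'"
    using decomp[of m'] by (simp add: of_nat_diff)
  ultimately show "real (S_max (pattern P0) n)
      \<le> real (n - n mod (k - 1)) * (real n + real (n mod (k - 1)) - real k + 1) / (2 * real k - 2)"
    using m' decomp[of m'] by (simp add: cancel del: of_nat_Suc) (simp add: field_simps)
qed

end
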